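(* Let $(J_4,\circ)$ be the Jordan algebra over $\mathbb{C}$ with basis $\{e_1,e_2\}$ and $e_1\circ e_1=2e_1$, $e_1\circ e_2=e_2\circ e_1=e_2$, $e_2\circ e_2=0$. Any Rota-Baxter operator on $(J_4,\circ)$ is of the form $$\begin{pmatrix} \lambda\mu&-\lambda^2\\ \mu^2&-\lambda\mu\end{pmatrix}$$ with $\lambda,\mu\in\mathbb{C}$. When $\lambda\neq0$, the induced pre-Jordan algebra is isomorphic to $J_{2,2}$; when $\lambda=0$ and $\mu\neq0$, it is isomorphic to $J_{5,1}$; when $\lambda=\mu=0$, it is isomorphic to $J_{6,1}$.
   Context: A Rota-Baxter operator (of weight $0$) on a Jordan algebra $(J,\circ)$ is a linear map $R:J\to J$ with $R(x)\circ R(y)=R(R(x)\circ y+x\circ R(y))$ for all $x,y\in J$. The matrix $(r_{ij})$ of $R$ in a basis $\{e_i\}$ is defined by $R(e_i)=\sum_j r_{ji}e_j$. The pre-Jordan algebra induced by $R$ is $J$ with the multiplication $x\cdot y:=R(x)\circ y$. Isomorphisms are bijective linear maps preserving the multiplication $\cdot$. The following algebras have basis $\{e_1,e_2\}$, with unlisted products of basis elements equal to zero: $J_{2,2}$: $e_1\cdot e_1=e_1$, $e_1\cdot e_2=2e_2$; $J_{5,1}$: $e_1\cdot e_1=e_2$; $J_{6,1}$: all products zero. *)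

theory Defs
  imports "HOL-Analysis.Analysis"
begin

abbreviation clinear_map :: "(complex^'n \<Rightarrow> complex^'m) \<Rightarrow> bool" where
  "clinear_map \<equiv> Vector_Spaces.linear (*s) (*s)"

definition jordan_algebra :: "(complex^'n \<Rightarrow> complex^'n \<Rightarrow> complex^'n) \<Rightarrow> bool" where
  "jordan_algebra m \<longleftrightarrow>
     (\<forall>x. clinear_map (\<lambda>y. m x y)) \<and> (\<forall>y. clinear_map (\<lambda>x. m x y)) \<and>
     (\<forall>x y. m x y = m y x) \<and>
     (\<forall>x y. m (m (m x x) y) x = m (m x x) (m y x))"

definition rota_baxter :: "(complex^'n \<Rightarrow> complex^'n \<Rightarrow> complex^'n) \<Rightarrow> (complex^'n \<Rightarrow> complex^'n) \<Rightarrow> bool" where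
  "rota_baxter m R \<longleftrightarrow>
     clinear_map R \<and> (\<forall>x y. m (R x) (R y) = R (m (R x) y + m x (R y)))"

definition induced_mult ::
  "(complex^'n \<Rightarrow> complex^'n \<Rightarrow> complex^'n) \<Rightarrow> (complex^'n \<Rightarrow> complex^'n) \<Rightarrow> complex^'n \<Rightarrow> complex^'n \<Rightarrow> complex^'n" where
  "induced_mult m R x y = m (R x) y"

definition algebra_isomorphic ::
  "(complex^'n \<Rightarrow> complex^'n \<Rightarrow> complex^'n) \<Rightarrow> (complex^'m \<Rightarrow> complex^'m \<Rightarrow> complex^'m) \<Rightarrow> bool" where
  "algebra_isomorphic m m' \<longleftrightarrow>
     (\<exists>\<phi>. clinear_map \<phi> \<and> bij \<phi> \<and> (\<forall>x y. \<phi> (m x y) = m' (\<phi> x) (\<phi> y)))"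

text \<open>The bilinear product whose value on the standard basis vectors number \<open>i\<close> and \<open>j\<close>
  is \<open>T $ i $ j\<close>.\<close>

definition table_mult :: "complex^'n^'n^'n \<Rightarrow> complex^'n \<Rightarrow> complex^'n \<Rightarrow> complex^'n" where
  "table_mult T x y = (\<Sum>i\<in>UNIV. \<Sum>j\<in>UNIV. (x $ i * y $ j) *s (T $ i $ j))"

lemma table_mult_axis [simp]: "table_mult T (axis i 1) (axis j 1) = T $ i $ j"
proof -
  have "(\<Sum>l\<in>UNIV. (axis i 1 $ k * axis j 1 $ l) *s (T $ k $ l)) =
        (if k = i then T $ i $ j else 0)" for k
  proof -
    have "(\<Sum>l\<in>UNIV. (axis i 1 $ k * axis j 1 $ l) *s (T $ k $ l)) =
          (\<Sum>l\<in>UNIV. if l = j then (if k = i then T $ i $ j else 0) else 0)"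
      by (rule sum.cong) (auto simp: axis_def)
    then show ?thesis
      by simp
  qed
  then show ?thesis
    by (simp add: table_mult_def)
qed

abbreviation e1 :: "complex^2" where "e1 \<equiv> axis 1 1"
abbreviation e2 :: "complex^2" where "e2 \<equiv> axis 2 1"

definition J4 :: "complex^2 \<Rightarrow> complex^2 \<Rightarrow> complex^2" where
  "J4 = table_mult (vector [vector [2 *s e1, e2], vector [e2, 0]])"

definition J22 :: "complex^2 \<Rightarrow> complex^2 \<Rightarrow> complex^2" where
  "J22 = table_mult (vector [vector [e1, 2 *s e2], vector [0, 0]])"

definition J51 :: "complex^2 \<Rightarrow> complex^2 \<Rightarrow> complex^2" where
  "J51 = table_mult (vector [vector [e2, 0], vector [0, 0]])"

definition J61 :: "complex^2 \<Rightarrow> complex^2 \<Rightarrow> complex^2" where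
  "J61 = table_mult (vector [vector [0, 0], vector [0, 0]])"

lemma J4_basis:
  "J4 e1 e1 = 2 *s e1" "J4 e1 e2 = e2" "J4 e2 e1 = e2" "J4 e2 e2 = 0"
  by (simp_all add: J4_def)

lemma J22_basis:
  "J22 e1 e1 = e1" "J22 e1 e2 = 2 *s e2" "J22 e2 e1 = 0" "J22 e2 e2 = 0"
  by (simp_all add: J22_def)

lemma J51_basis:
  "J51 e1 e1 = e2" "J51 e1 e2 = 0" "J51 e2 e1 = 0" "J51 e2 e2 = 0"
  by (simp_all add: J51_def)

lemma J61_basis:
  "J61 e1 e1 = 0" "J61 e1 e2 = 0" "J61 e2 e1 = 0" "J61 e2 e2 = 0"
  by (simp_all add: J61_def)

lemma clinear_table_mult:
  "clinear_map (\<lambda>y. table_mult T x y)" "clinear_map (\<lambda>x. table_mult T x y)"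
  by (unfold_locales;
      auto simp: table_mult_def vec_eq_iff sum.distrib sum_distrib_left algebra_simps)+

lemma J4_nth:
  "J4 x y $ 1 = 2 * x $ 1 * y $ 1" "J4 x y $ 2 = x $ 1 * y $ 2 + x $ 2 * y $ 1"
  by (simp_all add: J4_def table_mult_def sum_2 axis_def)

lemma jordan_algebra_J4: "jordan_algebra J4"
proof -
  have "clinear_map (\<lambda>y. J4 x y)" "clinear_map (\<lambda>y. J4 y x)" for x
    by (simp_all add: J4_def clinear_table_mult)
  moreover have "J4 x y = J4 y x" for x y
    by (simp add: vec_eq_iff forall_2 J4_nth)
  moreover have "J4 (J4 (J4 x x) y) x = J4 (J4 x x) (J4 y x)" for x y
    by (simp add: vec_eq_iff forall_2 J4_nth algebra_simps)
  ultimately show ?thesis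
    unfolding jordan_algebra_def by blast
qed

text \<open>The library function \<^const>\<open>matrix\<close> stores the image of the \<open>j\<close>-th basis
  vector in column \<open>j\<close>, so its entries are the \<open>r\<^sub>i\<^sub>j\<close> in
  \<open>R e\<^sub>i = \<Sum>\<^sub>j r\<^sub>j\<^sub>i e\<^sub>j\<close>; \<open>vector\<close> below lists the rows.\<close>

definition RB_matrix :: "complex \<Rightarrow> complex \<Rightarrow> complex^2^2" where
  "RB_matrix lam mu = vector [vector [lam * mu, - (lam\<^sup>2)], vector [mu\<^sup>2, - (lam * mu)]]"

end

theory Submission
  imports Defs
begin

text \<open>
  Write \<open>f\<close> for the first coordinate functional. The product of \<open>J4\<close> is
  \<open>x \<circ> y = f x y + f y x\<close>. Substituting this into the Rota-Baxter identity of a linear map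
  \<open>R\<close>, the two terms \<open>f (R x) R y + f (R y) R x\<close> appear on both sides and cancel, which leaves
  \<open>f y R (R x) + f x R (R y) = 0\<close>. Since \<open>f e1 = 1\<close>, this says exactly that \<open>R\<close> squares to zero
  (\<open>rota_baxter_J4_iff_square_zero\<close>).

  A \<open>2 \<times> 2\<close> matrix with square zero has trace and determinant zero, so its rank is at most one
  and its image lies in its kernel. Over a field with square roots it is therefore
  \<open>x \<mapsto> \<omega> x v\<close> with \<open>v = (\<lambda>, \<mu>)\<close> and \<open>\<omega> x = \<mu> x\<^sub>1 - \<lambda> x\<^sub>2\<close>, a functional that vanishes
  on \<open>v\<close>; this is the displayed matrix (\<open>square_zero_iff_RB_matrix\<close>).

  The induced product is then \<open>x \<cdot> y = \<omega> x (\<lambda> y + y\<^sub>1 v)\<close>. If \<open>\<lambda> \<noteq> 0\<close>, the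
  operator \<open>y \<mapsto> \<lambda> y + y\<^sub>1 v\<close> has the eigenvectors \<open>e2\<close> and \<open>v\<close> with eigenvalues
  \<open>\<lambda>\<close> and \<open>2\<lambda>\<close>, so \<open>-\<lambda>\<^sup>-\<^sup>2 e2\<close> and \<open>v\<close> multiply like the basis of
  \<open>J22\<close>. If \<open>\<lambda> = 0\<close>, the product is \<open>\<mu>\<^sup>2 x\<^sub>1 y\<^sub>1 e2\<close>, which is \<open>J51\<close> after
  rescaling, or zero.
\<close>

lemma vec2_eq_iff: "(x :: 'a^2) = y \<longleftrightarrow> x $ 1 = y $ 1 \<and> x $ 2 = y $ 2"
  by (simp add: vec_eq_iff forall_2)

lemma matrix_vector_mult_2:
  fixes A :: "'a::semiring_1^2^2"
  shows "(A *v x) $ i = A $ i $ 1 * x $ 1 + A $ i $ 2 * x $ 2"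
  by (simp add: matrix_vector_mult_def sum_2)

lemma clinear_map_eq_matrix_mult:
  assumes "clinear_map R"
  shows "R x = matrix R *v x"
  using matrix_works[OF assms] by simp

lemma algebra_isomorphic_via_matrix:
  fixes A :: "complex^'n^'n"
  assumes "det A \<noteq> 0" and "\<And>x y. A *v m x y = m' (A *v x) (A *v y)"
  shows "algebra_isomorphic m m'"
proof -
  from assms(1) obtain B where "A ** B = mat 1" "B ** A = mat 1"
    by (auto simp: invertible_det_nz[symmetric] invertible_def)
  then have "bij ((*v) A)"
    by (intro o_bij[of "(*v) B"]) (auto simp: fun_eq_iff matrix_vector_mul_assoc)
  moreover have "clinear_map ((*v) A)"
    by (rule matrix_vector_mul_linear_gen)
  ultimately show ?thesis
    unfolding algebra_isomorphic_def using assms(2) by blast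
qed

lemma J4_eq_first_coordinate: "J4 x y = x $ 1 *s y + y $ 1 *s x"
  by (simp add: vec2_eq_iff J4_nth)

text \<open>
  After cancellation the Rota-Baxter identity is \<open>y\<^sub>1 R (R x) + x\<^sub>1 R (R y) = 0\<close>. Taking
  both arguments to be \<open>e1\<close> gives \<open>2 R (R e1) = 0\<close>; then \<open>x = e1\<close> with \<open>y\<close> arbitrary leaves
  \<open>R (R y) = 0\<close>.
\<close>

lemma rota_baxter_J4_iff_square_zero:
  "rota_baxter J4 R \<longleftrightarrow> clinear_map R \<and> (\<forall>x. R (R x) = 0)"
proof (cases "clinear_map R")
  case True
  interpret Vector_Spaces.linear "(*s)" "(*s)" R by (rule True)
  have identity_iff: "J4 (R x) (R y) = R (J4 (R x) y + J4 x (R y)) \<longleftrightarrow>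
      y $ 1 *s R (R x) + x $ 1 *s R (R y) = 0" for x y
    by (auto simp: J4_eq_first_coordinate add scale vec2_eq_iff algebra_simps)
  have "(\<forall>x y. y $ 1 *s R (R x) + x $ 1 *s R (R y) = 0) \<longleftrightarrow> (\<forall>x. R (R x) = 0)"
  proof
    assume vanish: "\<forall>x y. y $ 1 *s R (R x) + x $ 1 *s R (R y) = 0"
    have "R (R e1) = 0"
      using vanish[rule_format, of e1 e1] by (simp add: vec2_eq_iff axis_def)
    then show "\<forall>x. R (R x) = 0"
      using vanish[rule_format, of e1] by (simp add: axis_def)
  qed simp
  then show ?thesis
    using True by (simp add: rota_baxter_def identity_iff)
qed (simp add: rota_baxter_def)

lemma RB_matrix_nth:
  "RB_matrix l u $ 1 $ 1 = l * u" "RB_matrix l u $ 1 $ 2 = - (l\<^sup>2)"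
  "RB_matrix l u $ 2 $ 1 = u\<^sup>2" "RB_matrix l u $ 2 $ 2 = - (l * u)"
  by (simp_all add: RB_matrix_def)

text \<open>
  For entries \<open>a, b, c, d\<close>, square zero forces \<open>d = - a\<close> (otherwise
  \<open>b (a + d) = 0\<close> gives \<open>b = 0\<close>, hence \<open>a = d = 0\<close>) and \<open>a\<^sup>2 = - b c\<close>. Thus \<open>\<lambda>\<close> must be a
  square root of \<open>- b\<close>, and then \<open>\<mu> = a / \<lambda>\<close>, unless \<open>b = 0\<close>, when \<open>a = 0\<close> and
  \<open>\<mu>\<close> is a square root of \<open>c\<close>.
\<close>

lemma square_zero_iff_RB_matrix:
  fixes A :: "complex^2^2"
  shows "A ** A = 0 \<longleftrightarrow> (\<exists>l u. A = RB_matrix l u)"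
proof
  assume sq: "A ** A = 0"
  define a b c d where "a = A $ 1 $ 1" "b = A $ 1 $ 2" "c = A $ 2 $ 1" "d = A $ 2 $ 2"
  note entries = this
  have eqs: "a * a + b * c = 0" "a * b + b * d = 0" "c * a + d * c = 0" "c * b + d * d = 0"
    using sq by (simp_all add: vec2_eq_iff matrix_matrix_mult_def sum_2 entries)
  have "d = - a"
  proof (rule ccontr)
    assume "d \<noteq> - a"
    then have "a + d \<noteq> 0"
      by (metis add_eq_0_iff)
    moreover have "b * (a + d) = 0"
      using eqs(2) by (simp add: algebra_simps)
    ultimately have "b = 0"
      by simp
    with eqs \<open>d \<noteq> - a\<close> show False
      by simp
  qed
  have "\<exists>l u. a = l * u \<and> b = - (l\<^sup>2) \<and> c = u\<^sup>2"
  proof (cases "b = 0")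
    case True
    with eqs show ?thesis
      by (intro exI[of _ 0] exI[of _ "csqrt c"]) simp
  next
    case False
    define l where "l = csqrt (- b)"
    have l: "l\<^sup>2 = - b" "l \<noteq> 0"
      using False by (simp_all add: l_def)
    have "c = (a / l)\<^sup>2"
      using eqs(1) False l(1)
      by (simp add: power_divide field_simps power2_eq_square add_eq_0_iff)
    with l show ?thesis
      by (intro exI[of _ l] exI[of _ "a / l"]) simp
  qed
  with \<open>d = - a\<close> show "\<exists>l u. A = RB_matrix l u"
    by (auto simp: vec2_eq_iff RB_matrix_nth entries)
next
  assume "\<exists>l u. A = RB_matrix l u"
  then show "A ** A = 0"
    by (auto simp: vec2_eq_iff matrix_matrix_mult_def sum_2 RB_matrix_nth
        power2_eq_square algebra_simps)
qed

lemma rota_baxter_J4_iff_RB_matrix: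
  "rota_baxter J4 R \<longleftrightarrow> clinear_map R \<and> (\<exists>l u. matrix R = RB_matrix l u)"
proof (cases "clinear_map R")
  case True
  have "(\<forall>x. R (R x) = 0) \<longleftrightarrow> (\<forall>x. (matrix R ** matrix R) *v x = 0)"
    by (simp add: clinear_map_eq_matrix_mult[OF True] matrix_vector_mul_assoc)
  also have "\<dots> \<longleftrightarrow> matrix R ** matrix R = 0"
    using matrix_eq[of "matrix R ** matrix R" 0] by simp
  finally show ?thesis
    using True by (simp add: rota_baxter_J4_iff_square_zero square_zero_iff_RB_matrix)
qed (simp add: rota_baxter_def)

text \<open>These are the coordinates of \<open>\<omega> x (\<lambda> y + y\<^sub>1 v)\<close> with \<open>v = (\<lambda>, \<mu>)\<close> and \<open>\<omega> x = \<mu> x\<^sub>1 - \<lambda> x\<^sub>2\<close>.\<close>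

lemma induced_mult_J4_nth:
  assumes "clinear_map R" and "matrix R = RB_matrix l u"
  shows "induced_mult J4 R x y $ 1 = (u * x $ 1 - l * x $ 2) * (2 * l * y $ 1)"
    and "induced_mult J4 R x y $ 2 = (u * x $ 1 - l * x $ 2) * (l * y $ 2 + u * y $ 1)"
  using assms
  by (simp_all add: induced_mult_def J4_nth clinear_map_eq_matrix_mult[OF assms(1)]
      matrix_vector_mult_2 RB_matrix_nth power2_eq_square algebra_simps)

lemma J22_nth: "J22 x y $ 1 = x $ 1 * y $ 1" "J22 x y $ 2 = 2 * x $ 1 * y $ 2"
  by (simp_all add: J22_def table_mult_def sum_2 axis_def)

lemma J51_nth: "J51 x y $ 1 = 0" "J51 x y $ 2 = x $ 1 * y $ 1"
  by (simp_all add: J51_def table_mult_def sum_2 axis_def)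

lemma J61_eq_0: "J61 x y = 0"
  by (simp add: J61_def table_mult_def sum_2)

text \<open>
  The isomorphism is \<open>x \<mapsto> (\<lambda> \<omega> x, x\<^sub>1)\<close>. It sends the idempotent \<open>-\<lambda>\<^sup>-\<^sup>2 e2\<close> to \<open>e1\<close>
  and \<open>v\<close> to \<open>\<lambda> e2\<close>; the factor \<open>\<lambda>\<close> is harmless because rescaling \<open>e2\<close> is an
  automorphism of \<open>J22\<close>.
\<close>

lemma induced_mult_isomorphic_J22:
  assumes "clinear_map R" and "matrix R = RB_matrix l u" and "l \<noteq> 0"
  shows "algebra_isomorphic (induced_mult J4 R) J22"
proof (rule algebra_isomorphic_via_matrix)
  let ?A = "vector [vector [l * u, - (l\<^sup>2)], vector [1, 0]] :: complex^2^2"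
  show "det ?A \<noteq> 0"
    using assms(3) by (simp add: det_2)
  show "?A *v induced_mult J4 R x y = J22 (?A *v x) (?A *v y)" for x y
    by (simp add: vec2_eq_iff matrix_vector_mult_2 J22_nth
        induced_mult_J4_nth[OF assms(1,2)] power2_eq_square algebra_simps)
qed

lemma induced_mult_isomorphic_J51:
  assumes "clinear_map R" and "matrix R = RB_matrix 0 u" and "u \<noteq> 0"
  shows "algebra_isomorphic (induced_mult J4 R) J51"
proof (rule algebra_isomorphic_via_matrix)
  let ?A = "vector [vector [u, 0], vector [0, 1]] :: complex^2^2"
  show "det ?A \<noteq> 0"
    using assms(3) by (simp add: det_2)
  show "?A *v induced_mult J4 R x y = J51 (?A *v x) (?A *v y)" for x y
    by (simp add: vec2_eq_iff matrix_vector_mult_2 J51_nth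
        induced_mult_J4_nth[OF assms(1,2)])
qed

lemma induced_mult_isomorphic_J61:
  assumes "clinear_map R" and "matrix R = RB_matrix 0 0"
  shows "algebra_isomorphic (induced_mult J4 R) J61"
proof (rule algebra_isomorphic_via_matrix)
  show "det (mat 1 :: complex^2^2) \<noteq> 0"
    by simp
  show "mat 1 *v induced_mult J4 R x y = J61 (mat 1 *v x) (mat 1 *v y)" for x y
    by (simp add: vec2_eq_iff J61_eq_0 induced_mult_J4_nth[OF assms])
qed

theorem proposition5p8:
  "(\<forall>R :: complex^2 \<Rightarrow> complex^2.
      rota_baxter J4 R \<longleftrightarrow>
      clinear_map R \<and> (\<exists>lam mu :: complex. matrix R = RB_matrix lam mu)) \<and>
   (\<forall>(R :: complex^2 \<Rightarrow> complex^2) (lam :: complex) (mu :: complex).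
      rota_baxter J4 R \<and> matrix R = RB_matrix lam mu \<longrightarrow>
        (lam \<noteq> 0 \<longrightarrow> algebra_isomorphic (induced_mult J4 R) J22) \<and>
        (lam = 0 \<and> mu \<noteq> 0 \<longrightarrow> algebra_isomorphic (induced_mult J4 R) J51) \<and>
        (lam = 0 \<and> mu = 0 \<longrightarrow> algebra_isomorphic (induced_mult J4 R) J61))"
  by (simp add: rota_baxter_J4_iff_RB_matrix induced_mult_isomorphic_J22
      induced_mult_isomorphic_J51 induced_mult_isomorphic_J61)

end
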